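(* For $x\in[-1,1]$ put $a=1-x^2$. Define $Q_0(z)=\frac12$ and, for $m\ge 1$, $$Q_{m}(z) = \frac{1}{2} (m+1)!\, (az)^m + (1-az)\, z \frac{d}{dz} Q_{m-1}(z) + (1-az)\, z \sum_{j=1}^{m-1} \binom {m+1}{j} j!\, (az)^j \frac{d}{dz} Q_{m-(j+1)}(z),$$ where $d/dz$ is taken with $a$ treated as a constant (so that $Q_m$ depends on $x$ through $a$). Then for each integer $m\ge 0$, $Q_m(z)$ is a polynomial in $z$ of degree $m$ (with coefficients depending polynomially on $a$), and for all $|z|<1$ $$g_m(z) = \int_{-1}^1 \frac{Q_m(z)}{(1-z(1-x^2))^{m+2}}\, dx.$$
   Context: $C_n=\frac{1}{n+1}\binom{2n}{n}$ ($n\ge 0$) denotes the $n$-th Catalan number. For each integer $m\ge 0$ and $|z|<1$, $$g_m(z)=\sum_{n=0}^\infty \frac{2^{2n}n^m}{2n+1}\frac{z^n}{C_n},$$ with the convention $0^0=1$. The degree of $Q_m$ is meant as a polynomial in $z$ with $a$ regarded as an indeterminate parameter. Empty sums are zero. *)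

theory Defs
  imports "HOL-Analysis.Analysis" "HOL-Computational_Algebra.Polynomial"
begin

definition catalan :: "nat \<Rightarrow> real" where
  "catalan n = 1 / (real n + 1) * real ((2 * n) choose n)"

definition g_term :: "nat \<Rightarrow> complex \<Rightarrow> nat \<Rightarrow> complex" where
  "g_term m z n =
     2 ^ (2 * n) * of_nat n ^ m / (2 * of_nat n + 1) * (z ^ n / of_real (catalan n))"

definition g :: "nat \<Rightarrow> complex \<Rightarrow> complex" where
  "g m z = (\<Sum>n. g_term m z n)"

text \<open>The parameter \<open>a\<close> is held constant in \<open>deriv\<close>; it is instantiated to \<open>1 - x\<^sup>2\<close> only
  afterwards. That the functions are polynomials is not built into the definition.\<close>

function Q :: "nat \<Rightarrow> real \<Rightarrow> complex \<Rightarrow> complex" where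
  "Q m a z =
    (if m = 0 then 1 / 2
     else 1 / 2 * fact (m + 1) * (of_real a * z) ^ m
        + (1 - of_real a * z) * z * deriv (\<lambda>w. Q (m - 1) a w) z
        + (1 - of_real a * z) * z *
            (\<Sum>j = 1..m - 1. of_nat ((m + 1) choose j) * fact j * (of_real a * z) ^ j
               * deriv (\<lambda>w. Q (m - (j + 1)) a w) z))"
  by auto
termination
  by (relation "Wellfounded.measure (\<lambda>(m, a, z). m)") auto

declare Q.simps [simp del]

text \<open>A \<open>real poly poly\<close> is read as a polynomial in \<open>z\<close> (outer variable) whose coefficients are
  polynomials in the indeterminate \<open>a\<close> (inner variable), so \<open>degree\<close> is the degree in \<open>z\<close>.\<close>

definition eval2 :: "real poly poly \<Rightarrow> real \<Rightarrow> complex \<Rightarrow> complex" where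
  "eval2 P a z = poly (map_poly (\<lambda>c. of_real (poly c a)) P) z"

end

theory Submission imports Defs begin

text \<open>
  The integral \<open>\<integral>\<^sub>-\<^sub>1\<^sup>1 (1 - x\<^sup>2)\<^sup>n dx\<close> equals \<open>2 \<cdot> 4\<^sup>n / ((2n + 1) binom(2n, n))\<close>, so the \<open>n\<close>-th term of
  the series for \<open>g\<^sub>m(z)\<close> is the integral over \<open>[-1, 1]\<close> of \<open>(n + 1) n\<^sup>m u\<^sup>n / 2\<close> with \<open>u = a z\<close> and
  \<open>a = 1 - x\<^sup>2\<close>. For \<open>|z| < 1\<close> these functions of \<open>x\<close> are dominated by a convergent series of
  constants, so sum and integral may be exchanged, and everything reduces to summing
  \<open>\<Sum> (n + 1) n\<^sup>m u\<^sup>n / 2\<close>.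

  Inserting one more factor \<open>n\<close> means applying \<open>\<theta> = u d/du\<close>. Starting from \<open>1 / (2 (1 - u)\<^sup>2)\<close>, the
  \<open>m\<close>-fold application gives \<open>N\<^sub>m(u) / (1 - u)\<^bsup>m+2\<^esup>\<close>, where by the quotient rule
  \<open>N\<^sub>m\<^sub>+\<^sub>1 = (1 - u) \<theta> N\<^sub>m + (m + 2) u N\<^sub>m\<close> (\<open>sums_numer\<close>). Repeatedly replacing the last
  \<open>N\<close> by this same rule, down to \<open>N\<^sub>0 = 1/2\<close>, turns the one-step recurrence into one that
  consists of \<open>(m + 1)! u\<^sup>m / 2\<close> and the derivatives of all earlier \<open>N\<^sub>i\<close>, with coefficients
  \<open>(m + 1) m \<cdots> (m + 2 - j) = binom(m + 1, j) j!\<close> (\<open>numer_full_history\<close>). That is the recurrence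
  defining \<open>Q\<^sub>m\<close>, because \<open>z d/dz\<close> acts on functions of \<open>a z\<close> as \<open>\<theta>\<close> does; hence
  \<open>Q\<^sub>m(z) = N\<^sub>m(a z)\<close> (\<open>Q_eq_numer\<close>).

  The leading coefficient of \<open>N\<^sub>m\<close> doubles at each step, as \<open>(m + 2) - m = 2\<close>, so it is
  \<open>2\<^sup>m / 2\<close>. The coefficient of \<open>z\<^sup>m\<close> in \<open>Q\<^sub>m\<close> is therefore \<open>2\<^sup>m a\<^sup>m / 2\<close>, a nonzero polynomial
  in \<open>a\<close>, and the degree in \<open>z\<close> is exactly \<open>m\<close>.
\<close>

section \<open>The numerator polynomials\<close>

text \<open>These are the \<open>N\<^sub>m\<close> above, close relatives of the Eulerian polynomials. The coefficient type
  is left open because the same polynomials are used over the reals, for coefficients in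
  \<open>\<real>[a]\<close> and for the dominating series, and over the complex numbers, for values at \<open>a z\<close>.\<close>

primrec numer :: "nat \<Rightarrow> 'a::field_char_0 poly" where
  "numer 0 = [:1/2:]"
| "numer (Suc m) =
     [:0, 1, -1:] * pderiv (numer m) + of_nat (m + 2) * ([:0, 1:] * numer m)"

lemma coeff_numer_Suc:
  "coeff (numer (Suc m)) 0 = (0::'a::field_char_0)"
  "coeff (numer (Suc m) :: 'a::field_char_0 poly) (Suc k) =
     of_nat (Suc k) * coeff (numer m) (Suc k) + (of_nat (m + 2) - of_nat k) * coeff (numer m) k"
proof -
  have "coeff (numer (Suc m)) n =
    (case n of 0 \<Rightarrow> (0::'a) | Suc k \<Rightarrow> of_nat (Suc k) * coeff (numer m) (Suc k)
        + (of_nat (m + 2) - of_nat k) * coeff (numer m) k)" for n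
    unfolding numer.simps of_nat_poly
    by (auto simp: coeff_pCons coeff_pderiv algebra_simps split: nat.splits)
  from this[of 0] this[of "Suc k"]
  show "coeff (numer (Suc m)) 0 = (0::'a)"
    "coeff (numer (Suc m) :: 'a poly) (Suc k) =
     of_nat (Suc k) * coeff (numer m) (Suc k) + (of_nat (m + 2) - of_nat k) * coeff (numer m) k"
    by simp_all
qed

lemma coeff_numer_of_real:
  "coeff (numer m :: complex poly) k = of_real (coeff (numer m) k)"
proof (induction m arbitrary: k)
  case (Suc m)
  then show ?case
    by (cases k) (simp_all add: coeff_numer_Suc del: numer.simps)
qed (simp add: coeff_pCons split: nat.splits)

lemma coeff_numer_above: "m < k \<Longrightarrow> coeff (numer m) k = 0"
proof (induction m arbitrary: k)
  case (Suc m)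
  then show ?case
    by (cases k) (simp_all add: coeff_numer_Suc del: numer.simps)
qed (simp add: coeff_pCons split: nat.splits)

lemma lead_coeff_numer: "coeff (numer m :: 'a::field_char_0 poly) m = 2 ^ m / 2"
  by (induction m) (simp_all add: coeff_numer_Suc coeff_numer_above mult.commute del: numer.simps(2))

lemma degree_numer_le: "degree (numer m) \<le> m"
  by (rule degree_le) (simp add: coeff_numer_above)

text \<open>The bivariate polynomial \<open>N\<^sub>m(a z)\<close>: each \<open>u\<^sup>k\<close> becomes \<open>a\<^sup>k z\<^sup>k\<close>, with \<open>a\<close> the inner and \<open>z\<close> the
  outer variable.\<close>

definition numer2 :: "nat \<Rightarrow> real poly poly" where
  "numer2 m = (\<Sum>k\<le>m. monom (monom (coeff (numer m) k) k) k)"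

lemma coeff_numer2: "coeff (numer2 m) k = monom (coeff (numer m) k) k"
  by (simp add: numer2_def coeff_sum coeff_numer_above)

lemma degree_numer2: "degree (numer2 m) = m"
proof (rule antisym)
  show "degree (numer2 m) \<le> m"
    by (rule degree_le) (simp add: coeff_numer2 coeff_numer_above)
  show "m \<le> degree (numer2 m)"
    by (rule le_degree) (simp add: coeff_numer2 lead_coeff_numer)
qed

lemma poly_eq_sum_atMost:
  fixes x :: "'a::comm_semiring_1"
  assumes "degree p \<le> n"
  shows "poly p x = (\<Sum>k\<le>n. coeff p k * x ^ k)"
  by (subst poly_as_sum_of_monoms'[OF assms, symmetric]) (simp add: poly_sum poly_monom)

lemma eval2_numer2: "eval2 (numer2 m) a z = poly (numer m) (of_real a * z)"
proof -
  have "degree (map_poly (\<lambda>c. complex_of_real (poly c a)) (numer2 m)) \<le> m"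
    by (rule degree_le) (simp add: coeff_map_poly coeff_numer2 coeff_numer_above)
  then have "eval2 (numer2 m) a z = (\<Sum>k\<le>m. of_real (coeff (numer m) k * a ^ k) * z ^ k)"
    unfolding eval2_def by (simp add: poly_eq_sum_atMost coeff_map_poly coeff_numer2 poly_monom)
  also have "\<dots> = poly (numer m) (of_real a * z)"
    by (simp add: poly_eq_sum_atMost[OF degree_numer_le] coeff_numer_of_real power_mult_distrib mult_ac)
  finally show ?thesis .
qed

section \<open>Identification with the recursion for Q\<close>

text \<open>The one-step recurrence, unrolled. Multiplying the formula for \<open>m\<close> by \<open>(m + 2) X\<close> shifts its
  sum by one index, since \<open>(m + 2) binom(m + 1, j) j! = binom(m + 2, j + 1) (j + 1)!\<close>; the
  derivative term of the one-step rule supplies the missing summand \<open>j = 0\<close>.\<close>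

lemma numer_full_history:
  "(numer m :: 'a::field_char_0 poly) =
     [:fact (m + 1) / 2:] * [:0, 1:] ^ m
     + (\<Sum>j<m. of_nat (((m + 1) choose j) * fact j) *
          ([:0, 1:] ^ j * ([:0, 1, -1:] * pderiv (numer (m - (j + 1))))))"
proof (induction m)
  case 0
  show ?case by (simp add: one_pCons)
next
  case (Suc m)
  let ?X = "[:0, 1:] :: 'a poly"
  let ?D = "\<lambda>i. [:0, 1, -1:] * pderiv (numer i) :: 'a poly"
  let ?t = "\<lambda>j. of_nat (((Suc m + 1) choose j) * fact j) * (?X ^ j * ?D (Suc m - (j + 1)))"
  have binom: "((Suc m + 1) choose Suc j) * fact (Suc j) = (m + 2) * (((m + 1) choose j) * fact j)"
    for j :: nat
    using Suc_times_binomial_eq[of "m + 1" j] by (simp add: algebra_simps)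
  have shift: "of_nat (m + 2) * (?X * (of_nat (((m + 1) choose j) * fact j) *
      (?X ^ j * ?D (m - (j + 1))))) = ?t (Suc j)" for j
    unfolding binom of_nat_mult by (simp add: mult_ac del: mult_pCons_left mult_pCons_right)
  have const: "of_nat (m + 2) * (?X * ([:fact (m + 1) / 2:] * ?X ^ m))
      = [:fact (Suc m + 1) / 2:] * ?X ^ Suc m"
  proof -
    have "[:fact (Suc m + 1) / 2:] = of_nat (m + 2) * [:fact (m + 1) / 2 :: 'a:]"
      by (simp add: of_nat_poly algebra_simps)
    then show ?thesis by (simp add: mult_ac del: mult_pCons_left mult_pCons_right)
  qed
  have "of_nat (m + 2) * (?X * numer m) =
      of_nat (m + 2) * (?X * ([:fact (m + 1) / 2:] * ?X ^ m)) +
      (\<Sum>j<m. of_nat (m + 2) * (?X * (of_nat (((m + 1) choose j) * fact j) *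
          (?X ^ j * ?D (m - (j + 1))))))"
    by (subst Suc.IH) (simp only: distrib_left sum_distrib_left)
  also have "\<dots> = [:fact (Suc m + 1) / 2:] * ?X ^ Suc m + (\<Sum>j<m. ?t (Suc j))"
    by (simp only: const shift)
  finally have "numer (Suc m) =
      [:fact (Suc m + 1) / 2:] * ?X ^ Suc m + (?t 0 + (\<Sum>j<m. ?t (Suc j)))"
    by (simp add: algebra_simps del: mult_pCons_left mult_pCons_right)
  then show ?case by (simp only: sum.lessThan_Suc_shift)
qed

lemma deriv_poly_scaled:
  "z * deriv (\<lambda>w. poly p (c * w)) z = c * z * poly (pderiv p) (c * z)" for c z :: complex
proof -
  have "((\<lambda>w. poly p (c * w)) has_field_derivative poly (pderiv p) (c * z) * c) (at z)"
    by (rule DERIV_chain'[OF _ poly_DERIV]) (auto intro!: derivative_eq_intros)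
  then show ?thesis by (simp add: DERIV_imp_deriv mult_ac)
qed

lemma Q_eq_numer: "Q m a z = poly (numer m) (of_real a * z)"
proof (induction m arbitrary: z rule: less_induct)
  case (less m)
  show ?case
  proof (cases m)
    case 0
    then show ?thesis by (simp add: Q.simps)
  next
    case (Suc n)
    let ?u = "of_real a * z"
    let ?D = "\<lambda>i. poly (pderiv (numer i)) ?u"
    have D: "z * deriv (\<lambda>w. Q i a w) z = ?u * ?D i" if "i < m" for i
      using less.IH[OF that] by (simp add: deriv_poly_scaled)
    have "Q m a z = 1 / 2 * fact (m + 1) * ?u ^ m + (1 - ?u) * (z * deriv (\<lambda>w. Q (m - 1) a w) z)
      + (\<Sum>j = 1..m - 1. of_nat ((m + 1) choose j) * fact j * ?u ^ j * (1 - ?u) *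
           (z * deriv (\<lambda>w. Q (m - (j + 1)) a w) z))"
      by (subst Q.simps) (simp add: Suc sum_distrib_left mult_ac)
    also have "\<dots> = 1 / 2 * fact (m + 1) * ?u ^ m + (1 - ?u) * (?u * ?D (m - 1))
      + (\<Sum>j = 1..m - 1. of_nat ((m + 1) choose j) * fact j * ?u ^ j * (1 - ?u) *
           (?u * ?D (m - (j + 1))))"
      using Suc by (intro arg_cong2[of _ _ _ _ "(+)"] sum.cong refl) (auto simp: D)
    \<comment> \<open>The recursion for \<open>Q\<close> lists the summand \<open>j = 0\<close> separately; it is put back into the sum.\<close>
    also have "\<dots> = 1 / 2 * fact (m + 1) * ?u ^ m + (\<Sum>j<m.
        of_nat ((m + 1) choose j) * fact j * ?u ^ j * (1 - ?u) * (?u * ?D (m - (j + 1))))"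
    proof -
      have "{..<m} = insert 0 {1..m - 1}" using Suc by auto
      then show ?thesis by simp
    qed
    also have "\<dots> = poly (numer m) ?u"
    proof -
      have "poly (fact j) ?u = fact j" for j
        by (metis of_nat_fact poly_of_nat)
      then show ?thesis
        by (subst numer_full_history[of m]) (simp add: poly_sum algebra_simps)
    qed
    finally show ?thesis .
  qed
qed

section \<open>The generating function\<close>

text \<open>Differentiating the power series termwise and multiplying by \<open>u\<close> inserts a factor \<open>n\<close>; the
  quotient rule on the other side produces the recurrence of \<^const>\<open>numer\<close>. The base
  case is the derivative of the geometric series.\<close>

lemma sums_numer:
  fixes u :: "'a::{real_normed_field,banach}"
  assumes "norm u < 1"
  shows "(\<lambda>n. of_nat (n + 1) * of_nat n ^ m / 2 * u ^ n) sums (poly (numer m) u / (1 - u) ^ (m + 2))"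
  using assms
proof (induction m arbitrary: u)
  case 0
  then show ?case
    using sums_divide[OF geometric_deriv_sums, of u 2] by (simp add: power2_eq_square mult.commute)
next
  case (Suc m)
  let ?c = "\<lambda>n. of_nat (n + 1) * of_nat n ^ m / 2 :: 'a"
  let ?f' = "(poly (pderiv (numer m)) u * (1 - u) + of_nat (m + 2) * poly (numer m) u) / (1 - u) ^ (m + 3)"
  from Suc.prems have u: "1 - u \<noteq> 0" by auto
  have "((\<lambda>u. poly (numer m) u / (1 - u) ^ (m + 2)) has_field_derivative ?f') (at u)"
  proof -
    have "((\<lambda>u. poly (numer m) u / (1 - u) ^ (m + 2)) has_field_derivative
       (poly (pderiv (numer m)) u * (1 - u) ^ (m + 2) -
         poly (numer m) u * (of_nat (m + 2) * (0 - 1) * (1 - u) ^ (m + 1))) /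
         ((1 - u) ^ (m + 2) * (1 - u) ^ (m + 2))) (at u)"
    proof (rule DERIV_divide[OF poly_DERIV])
      have "((\<lambda>u. 1 - u) has_field_derivative 0 - 1) (at u)"
        by (intro DERIV_diff DERIV_const DERIV_ident)
      from DERIV_power[OF this, of "m + 2"]
      show "((\<lambda>u. (1 - u) ^ (m + 2)) has_field_derivative
          of_nat (m + 2) * (0 - 1) * (1 - u) ^ (m + 1)) (at u)"
        by (simp add: algebra_simps)
    qed (use u in simp)
    also have "(poly (pderiv (numer m)) u * (1 - u) ^ (m + 2) -
         poly (numer m) u * (of_nat (m + 2) * (0 - 1) * (1 - u) ^ (m + 1))) /
         ((1 - u) ^ (m + 2) * (1 - u) ^ (m + 2)) = ?f'"
      using u by (simp add: divide_simps power_add power2_eq_square power3_eq_cube) (simp add: algebra_simps)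
    finally show ?thesis .
  qed
  from termdiffs_sums_strong[OF Suc.IH this Suc.prems]
  have "(\<lambda>n. u * (diffs ?c n * u ^ n)) sums (u * ?f')" by (rule sums_mult)
  also have "(\<lambda>n. u * (diffs ?c n * u ^ n)) =
      (\<lambda>n. of_nat (Suc n + 1) * of_nat (Suc n) ^ Suc m / 2 * u ^ Suc n)"
    by (simp add: diffs_def fun_eq_iff mult_ac)
  also have "u * ?f' = poly (numer (Suc m)) u / (1 - u) ^ (Suc m + 2)"
  proof -
    have "u * (poly (pderiv (numer m)) u * (1 - u) + of_nat (m + 2) * poly (numer m) u)
        = poly (numer (Suc m)) u"
      by (simp add: of_nat_poly algebra_simps)
    moreover have "Suc m + 2 = m + 3" by simp
    ultimately show ?thesis by (simp only: times_divide_eq_right)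
  qed
  \<comment> \<open>The series obtained starts at \<open>n = 1\<close>; the factor \<open>n ^ Suc m\<close> kills the term at \<open>n = 0\<close>.\<close>
  finally show ?case by (subst (asm) sums_Suc_iff) simp
qed

section \<open>Termwise integration\<close>

text \<open>Integrating the derivative of \<open>x (1 - x\<^sup>2)\<^bsup>n+1\<^esup>\<close>, which vanishes at both end points, relates
  consecutive integrals: \<open>(2n + 3) W\<^sub>n\<^sub>+\<^sub>1 = 2 (n + 1) W\<^sub>n\<close>. The closed form satisfies the same
  recurrence.\<close>

lemma wallis_integral:
  "((\<lambda>x::real. (1 - x\<^sup>2) ^ n) has_integral
      2 * 4 ^ n / ((2 * real n + 1) * real ((2 * n) choose n))) {-1..1}"
proof (induction n)
  case 0
  show ?case using has_integral_const_real[of "1::real" "-1" 1] by simp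
next
  case (Suc n)
  let ?W = "2 * 4 ^ n / ((2 * real n + 1) * real ((2 * n) choose n))"
  let ?B = "real ((2 * n) choose n)"
  have "((\<lambda>x::real. (2 * real n + 3) * (1 - x\<^sup>2) ^ Suc n - 2 * (real n + 1) * (1 - x\<^sup>2) ^ n) has_integral
      (1 * (1 - 1\<^sup>2) ^ Suc n - (-1) * (1 - (-1)\<^sup>2) ^ Suc n)) {-1..1}"
  proof (rule fundamental_theorem_of_calculus)
    fix x :: real
    have "((\<lambda>x. x * (1 - x\<^sup>2) ^ Suc n) has_real_derivative
        1 * (1 - x\<^sup>2) ^ Suc n + (real (Suc n) * (1 - x\<^sup>2) ^ n * (0 - 2 * x)) * x) (at x)"
      by (rule derivative_eq_intros refl | simp)+
    also have "1 * (1 - x\<^sup>2) ^ Suc n + (real (Suc n) * (1 - x\<^sup>2) ^ n * (0 - 2 * x)) * x =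
        (2 * real n + 3) * (1 - x\<^sup>2) ^ Suc n - 2 * (real n + 1) * (1 - x\<^sup>2) ^ n"
      by (simp add: algebra_simps power2_eq_square)
    finally show "((\<lambda>x. x * (1 - x\<^sup>2) ^ Suc n) has_vector_derivative
        (2 * real n + 3) * (1 - x\<^sup>2) ^ Suc n - 2 * (real n + 1) * (1 - x\<^sup>2) ^ n)
        (at x within {-1..1})"
      by (simp only: has_real_derivative_iff_has_vector_derivative has_vector_derivative_at_within)
  qed simp
  then have "((\<lambda>x::real. (2 * real n + 3) * (1 - x\<^sup>2) ^ Suc n - 2 * (real n + 1) * (1 - x\<^sup>2) ^ n)
      has_integral 0) {-1..1}" by simp
  from has_integral_add[OF this has_integral_mult_right[OF Suc.IH, of "2 * (real n + 1)"]]
  have "((\<lambda>x::real. (2 * real n + 3) * (1 - x\<^sup>2) ^ Suc n) has_integral 2 * (real n + 1) * ?W) {-1..1}"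
    by simp
  from has_integral_mult_right[OF this, of "1 / (2 * real n + 3)"]
  have *: "((\<lambda>x::real. (1 - x\<^sup>2) ^ Suc n) has_integral 2 * (real n + 1) * ?W / (2 * real n + 3)) {-1..1}"
    by (simp add: mult_ac)
  have "(real n + 1) * real ((2 * Suc n) choose Suc n) = 2 * (2 * real n + 1) * ?B"
  proof -
    have "real ((2 * Suc n) choose Suc n) = fact (Suc (Suc (2 * n))) / (fact (Suc n) * fact (Suc n))"
      using binomial_fact[of "Suc n" "2 * Suc n"] by simp
    moreover have "?B = fact (2 * n) / (fact n * fact n)"
      using binomial_fact[of n "2 * n"] by simp
    ultimately show ?thesis
      by (simp only: fact_Suc of_nat_Suc of_nat_mult) (simp add: divide_simps, simp add: algebra_simps)
  qed
  then have central: "real ((2 * Suc n) choose Suc n) = 2 * (2 * real n + 1) * ?B / (real n + 1)"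
    by (simp add: field_simps)
  have "2 * (real n + 1) * ?W / (2 * real n + 3) =
     2 * 4 ^ Suc n / ((2 * real (Suc n) + 1) * real ((2 * Suc n) choose Suc n))"
    unfolding central by (simp add: divide_simps) (simp add: algebra_simps)
  with * show ?case by (simp only:)
qed

text \<open>The factor \<open>n + 1\<close> in the integrand comes from the \<open>1/(n + 1)\<close> in the Catalan number.\<close>

lemma g_term_has_integral:
  "((\<lambda>x::real. of_nat (n + 1) * of_nat n ^ m / 2 * (of_real (1 - x\<^sup>2) * z) ^ n)
      has_integral g_term m z n) {-1..1}"
proof -
  let ?B = "real ((2 * n) choose n)"
  have "((\<lambda>x::real. complex_of_real ((1 - x\<^sup>2) ^ n)) has_integral
      of_real (2 * 4 ^ n / ((2 * real n + 1) * ?B))) {-1..1}"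
    by (rule has_integral_of_real[OF wallis_integral])
  from has_integral_mult_right[OF this, of "of_nat (n + 1) * of_nat n ^ m / 2 * z ^ n"]
  have "((\<lambda>x::real. of_nat (n + 1) * of_nat n ^ m / 2 * (of_real (1 - x\<^sup>2) * z) ^ n) has_integral
     of_nat (n + 1) * of_nat n ^ m / 2 * z ^ n * of_real (2 * 4 ^ n / ((2 * real n + 1) * ?B))) {-1..1}"
    by (simp add: power_mult_distrib mult_ac)
  also have "of_nat (n + 1) * of_nat n ^ m / 2 * z ^ n * of_real (2 * 4 ^ n / ((2 * real n + 1) * ?B))
      = g_term m z n"
  proof -
    have "N * p / 2 * w * (2 * q / (d * b)) = q * p / d * (w / (1 / N * b))"
      for N p w q d b :: complex
      by simp
    from this[of "of_nat (n + 1)" "of_nat n ^ m" "z ^ n" "4 ^ n" "2 * of_nat n + 1" "of_real ?B"]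
    show ?thesis by (simp add: g_term_def catalan_def power_mult)
  qed
  finally show ?thesis .
qed

text \<open>Since \<open>0 \<le> 1 - x\<^sup>2 \<le> 1\<close>, the series \<open>\<Sum> (n + 1) n\<^sup>m |z|\<^sup>n / 2\<close> dominates the integrands
  uniformly in \<open>x\<close>. The partial sums of \<open>g\<^sub>m(z)\<close> are then integrals of a uniformly convergent
  sequence, which gives the convergence of the series together with its value.\<close>

lemma g_integral:
  assumes z: "norm z < 1"
  shows "summable (g_term m z)"
    and "((\<lambda>x::real. poly (numer m) (of_real (1 - x\<^sup>2) * z) / (1 - of_real (1 - x\<^sup>2) * z) ^ (m + 2))
            has_integral g m z) {-1..1}"
proof -
  define t where "t = (\<lambda>n (x::real). of_nat (n + 1) * of_nat n ^ m / 2 * (of_real (1 - x\<^sup>2) * z) ^ n)"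
  let ?h = "\<lambda>x::real. poly (numer m) (of_real (1 - x\<^sup>2) * z) / (1 - of_real (1 - x\<^sup>2) * z) ^ (m + 2)"
  have bound: "norm (of_real (1 - x\<^sup>2) * z) \<le> norm z" if "x \<in> {-1..1}" for x :: real
  proof -
    have "x\<^sup>2 \<le> 1" using that by (simp add: abs_square_le_1 abs_le_iff)
    then have "\<bar>1 - x\<^sup>2\<bar> \<le> 1" by simp
    then show ?thesis unfolding norm_mult norm_of_real by (intro mult_left_le_one_le) auto
  qed
  have "uniform_limit {-1..1} (\<lambda>N x. \<Sum>n<N. t n x) (\<lambda>x. \<Sum>n. t n x) sequentially"
  proof (rule Weierstrass_m_test)
    show "summable (\<lambda>n. of_nat (n + 1) * of_nat n ^ m / 2 * norm z ^ n)"
      using sums_summable[OF sums_numer[of "norm z" m]] z by simp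
    show "norm (t n x) \<le> of_nat (n + 1) * of_nat n ^ m / 2 * norm z ^ n"
      if "x \<in> {-1..1}" for n x
    proof -
      have "norm (t n x) = of_nat (n + 1) * of_nat n ^ m / 2 * norm (of_real (1 - x\<^sup>2) * z) ^ n"
        unfolding t_def norm_mult norm_divide norm_power norm_of_nat by simp
      also have "\<dots> \<le> of_nat (n + 1) * of_nat n ^ m / 2 * norm z ^ n"
        by (intro mult_left_mono power_mono bound that) auto
      finally show ?thesis .
    qed
  qed
  then obtain I J where I: "\<And>N. ((\<lambda>x. \<Sum>n<N. t n x) has_integral I N) {-1..1}"
    and J: "((\<lambda>x. \<Sum>n. t n x) has_integral J) {-1..1}" and lim: "I \<longlonglongrightarrow> J"
    by (rule uniform_limit_integral) (auto simp: t_def intro!: continuous_intros)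
  have "(t n has_integral g_term m z n) {-1..1}" for n
    unfolding t_def by (rule g_term_has_integral)
  then have "I = (\<lambda>N. \<Sum>n<N. g_term m z n)"
    by (intro ext has_integral_unique[OF I has_integral_sum]) simp_all
  with lim have sums: "g_term m z sums J" by (simp add: sums_def)
  then show "summable (g_term m z)" by (rule sums_summable)
  have "(\<Sum>n. t n x) = ?h x" if "x \<in> {-1..1}" for x
    unfolding t_def using bound[OF that] z by (intro sums_unique[symmetric] sums_numer) simp
  then have "(?h has_integral J) {-1..1}" using J by (rule has_integral_eq)
  then show "(?h has_integral g m z) {-1..1}"
    by (simp only: g_def sums_unique[OF sums])
qed

theorem theorem7:
  fixes m :: nat
  shows "(\<exists>P :: real poly poly. degree P = m \<and>
            (\<forall>x\<in>{-1..1}. \<forall>z. Q m (1 - x\<^sup>2) z = eval2 P (1 - x\<^sup>2) z)) \<and>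
         (\<forall>z :: complex. norm z < 1 \<longrightarrow>
            summable (g_term m z) \<and>
            ((\<lambda>x :: real. Q m (1 - x\<^sup>2) z / (1 - z * (1 - of_real x ^ 2)) ^ (m + 2))
               has_integral g m z) {-1..1})"
proof (intro conjI allI impI)
  show "\<exists>P :: real poly poly. degree P = m \<and>
            (\<forall>x\<in>{-1..1}. \<forall>z. Q m (1 - x\<^sup>2) z = eval2 P (1 - x\<^sup>2) z)"
    using degree_numer2 by (auto simp: Q_eq_numer eval2_numer2 intro!: exI[of _ "numer2 m"])
  fix z :: complex assume z: "norm z < 1"
  show "summable (g_term m z)" by (rule g_integral(1)[OF z])
  show "((\<lambda>x :: real. Q m (1 - x\<^sup>2) z / (1 - z * (1 - of_real x ^ 2)) ^ (m + 2))
               has_integral g m z) {-1..1}"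
    using g_integral(2)[OF z, of m] by (simp add: Q_eq_numer mult.commute)
qed

end
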